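(* Let $\mathcal{M}$ be any stochastic one-way LOCC (1W-LOCC) from Bob to Alice, i.e. any map of the class $\mathsf{1WLOCC}$, acting on assemblages with parameters $(d,r,s)$ and producing assemblages with parameters $(d_f,r_f,s_f)$. If $\sigma_{A|X}$ is an unsteerable assemblage with parameters $(d,r,s)$, then $\mathcal{M}(\sigma_{A|X})$ is an unsteerable assemblage; that is, whenever $\mathrm{Tr}[\mathcal{M}(\sigma_{A|X})]\neq 0$, the normalised assemblage $\mathcal{M}(\sigma_{A|X})/\mathrm{Tr}[\mathcal{M}(\sigma_{A|X})]$ belongs to $\mathsf{LHS}$.
   Context: Notation: $[n]=\{0,\dots,n-1\}$. All index sets are finite and all Hilbert spaces finite-dimensional. Assemblages. Fix natural numbers $d,r,s\ge1$ and $\mathcal{H}_B=\mathbb{C}^d$. A (no-signaling) assemblage with parameters $(d,r,s)$ is a family $\rho_{A|X}=\{\varrho_{A|X}(a,x)\}_{a\in[r],x\in[s]}$ of positive semidefinite operators on $\mathcal{H}_B$ such that $\varrho_B:=\sum_a\varrho_{A|X}(a,x)$ does not depend on $x$. Its trace is $\mathrm{Tr}[\rho_{A|X}]:=\mathrm{Tr}[\varrho_B]$; it is normalised if this equals $1$. Scalar multiples and sums are taken componentwise. Unsteerable assemblages. A normalised assemblage $\sigma_{A|X}=\{\varsigma_{A|X}(a,x)\}$ is unsteerable, written $\sigma_{A|X}\in\mathsf{LHS}$, if there exist a probability distribution $P_\Lambda$ on a finite set, conditional probability distributions $P_{A|X\Lambda}$, and normalised states (density operators) $\xi(\lambda)$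 on $\mathcal{H}_B$ with $$\varsigma_{A|X}(a,x)=\sum_\lambda P_\Lambda(\lambda)P_{A|X\Lambda}(a,x,\lambda)\,\xi(\lambda)\quad\text{for all }a,x,$$ where $P_{A|X\Lambda}(a,x,\lambda)$ is the probability of $a$ given $x,\lambda$. Stochastic 1W-LOCCs. A map $\mathcal{M}$ of the class $\mathsf{1WLOCC}$ from assemblages with parameters $(d,r,s)$ to assemblages with parameters $(d_f,r_f,s_f)$ is specified by a finite set of $\omega$'s, operators $K_\omega:\mathbb{C}^d\to\mathbb{C}^{d_f}$ with $\sum_\omega K_\omega^\dagger K_\omega\le \mathbb{1}$, and normalised conditional probability distributions $P(x|x_f,\omega)$ (over $x\in[s]$, given $x_f\in[s_f]$ and $\omega$) and $P(a_f|a,x,\omega,x_f)$ (over $a_f\in[r_f]$, given $a\in[r],x,\omega,x_f$). It is $\mathcal{M}=\sum_\omega\mathcal{M}_\omega$, where $\mathcal{M}_\omega(\rho_{A|X})$ is the assemblage with components $$[\mathcal{M}_\omega(\rho_{A|X})](a_f,x_f)=\sum_{a,x}P(x|x_f,\omega)P(a_f|a,x,\omega,x_f)\,K_\omega\,\varrho_{A|X}(a,x)\,K_\omega^\dagger .$$ *)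

theory Defs
  imports "HOL-Analysis.Analysis"
begin

text \<open>
  A Hilbert space of dimension \<open>d \<ge> 1\<close> is \<open>complex ^ 'd\<close> with \<open>CARD('d) = d\<close>; operators from
  \<open>complex ^ 'd\<close> to \<open>complex ^ 'e\<close> are matrices in \<open>complex ^ 'd ^ 'e\<close>.
\<close>

definition dagger :: "complex ^ 'd ^ 'e \<Rightarrow> complex ^ 'e ^ 'd" where
  "dagger A = (\<chi> i j. cnj (A $ j $ i))"

definition psd :: "complex ^ 'd ^ 'd \<Rightarrow> bool" where
  "psd A \<longleftrightarrow> dagger A = A \<and> (\<forall>v. 0 \<le> Re (\<Sum>i\<in>UNIV. cnj (v $ i) * (A *v v) $ i))"

definition loewner_le :: "complex ^ 'd ^ 'd \<Rightarrow> complex ^ 'd ^ 'd \<Rightarrow> bool" where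
  "loewner_le A B \<longleftrightarrow> psd (B - A)"

definition density_operator :: "complex ^ 'd ^ 'd \<Rightarrow> bool" where
  "density_operator A \<longleftrightarrow> psd A \<and> trace A = 1"

definition prob_dist :: "'i set \<Rightarrow> ('i \<Rightarrow> real) \<Rightarrow> bool" where
  "prob_dist S p \<longleftrightarrow> finite S \<and> (\<forall>i\<in>S. 0 \<le> p i) \<and> (\<Sum>i\<in>S. p i) = 1"

text \<open>
  The component for outcome \<open>a\<close> and input \<open>x\<close> of \<open>\<rho>\<close> is \<open>\<rho> a x\<close>. Only the values with
  \<open>a < r\<close> and \<open>x < s\<close> are meaningful; the other values are never inspected below (for \<open>s \<ge> 1\<close>).
\<close>

type_synonym 'd assemblage = "nat \<Rightarrow> nat \<Rightarrow> complex ^ 'd ^ 'd"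

definition assemblage :: "nat \<Rightarrow> nat \<Rightarrow> 'd::finite assemblage \<Rightarrow> bool" where
  "assemblage r s \<rho> \<longleftrightarrow>
     (\<forall>a<r. \<forall>x<s. psd (\<rho> a x)) \<and>
     (\<forall>x<s. \<forall>x'<s. (\<Sum>a<r. \<rho> a x) = (\<Sum>a<r. \<rho> a x'))"

text \<open>
  By no-signaling the reduced operator may be computed at the input \<open>0\<close>. It is positive
  semidefinite, so its trace is real and taking the real part loses nothing.
\<close>

definition Tr :: "nat \<Rightarrow> 'd::finite assemblage \<Rightarrow> real" where
  "Tr r \<rho> = Re (trace (\<Sum>a<r. \<rho> a 0))"

definition scale_assemblage :: "real \<Rightarrow> 'd::finite assemblage \<Rightarrow> 'd assemblage" where
  "scale_assemblage c \<rho> = (\<lambda>a x. c *\<^sub>R \<rho> a x)"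

text \<open>
  Finite sets of hidden variables, and of Kraus indices further below, are taken to be finite sets
  of naturals, without loss of generality by relabelling; this avoids quantifying over types.
  In \<open>P\<^sub>A a x l\<close>, \<open>P\<^sub>i x x\<^sub>f \<omega>\<close> and \<open>P\<^sub>o a\<^sub>f a x \<omega> x\<^sub>f\<close> the first argument is the random one
  and the remaining ones are conditioned on.
\<close>

definition LHS :: "nat \<Rightarrow> nat \<Rightarrow> 'd::finite assemblage set" where
  "LHS r s = {\<sigma>. assemblage r s \<sigma> \<and> Tr r \<sigma> = 1 \<and>
     (\<exists>(\<Lambda> :: nat set) P\<^sub>\<Lambda> P\<^sub>A \<xi>.
        prob_dist \<Lambda> P\<^sub>\<Lambda> \<and>
        (\<forall>x<s. \<forall>l\<in>\<Lambda>. prob_dist {..<r} (\<lambda>a. P\<^sub>A a x l)) \<and>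
        (\<forall>l\<in>\<Lambda>. density_operator (\<xi> l)) \<and>
        (\<forall>a<r. \<forall>x<s. \<sigma> a x = (\<Sum>l\<in>\<Lambda>. (P\<^sub>\<Lambda> l * P\<^sub>A a x l) *\<^sub>R \<xi> l)))}"

definition locc_branch ::
  "nat \<Rightarrow> nat \<Rightarrow> ('w \<Rightarrow> complex ^ 'd ^ 'e) \<Rightarrow> (nat \<Rightarrow> nat \<Rightarrow> 'w \<Rightarrow> real) \<Rightarrow>
    (nat \<Rightarrow> nat \<Rightarrow> nat \<Rightarrow> 'w \<Rightarrow> nat \<Rightarrow> real) \<Rightarrow> 'w \<Rightarrow> 'd::finite assemblage \<Rightarrow> 'e::finite assemblage"
where
  "locc_branch r s K P\<^sub>i P\<^sub>o \<omega> \<rho> = (\<lambda>a\<^sub>f x\<^sub>f.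
     \<Sum>a<r. \<Sum>x<s. (P\<^sub>i x x\<^sub>f \<omega> * P\<^sub>o a\<^sub>f a x \<omega> x\<^sub>f) *\<^sub>R (K \<omega> ** \<rho> a x ** dagger (K \<omega>)))"

text \<open>
  A map of the class is determined only on assemblages with parameters \<open>(d, r, s)\<close>, and there only
  up to the meaningful components of its output.
\<close>

definition oneW_LOCC ::
  "nat \<Rightarrow> nat \<Rightarrow> nat \<Rightarrow> nat \<Rightarrow> ('d::finite assemblage \<Rightarrow> 'e::finite assemblage) set" where
  "oneW_LOCC r s r\<^sub>f s\<^sub>f = {\<M>.
     \<exists>(\<Omega> :: nat set) K P\<^sub>i P\<^sub>o.
        finite \<Omega> \<and>
        loewner_le (\<Sum>\<omega>\<in>\<Omega>. dagger (K \<omega>) ** K \<omega>) (mat 1) \<and>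
        (\<forall>\<omega>\<in>\<Omega>. \<forall>x\<^sub>f<s\<^sub>f. prob_dist {..<s} (\<lambda>x. P\<^sub>i x x\<^sub>f \<omega>)) \<and>
        (\<forall>\<omega>\<in>\<Omega>. \<forall>x\<^sub>f<s\<^sub>f. \<forall>a<r. \<forall>x<s. prob_dist {..<r\<^sub>f} (\<lambda>a\<^sub>f. P\<^sub>o a\<^sub>f a x \<omega> x\<^sub>f)) \<and>
        (\<forall>\<rho>. assemblage r s \<rho> \<longrightarrow>
           (\<forall>a\<^sub>f<r\<^sub>f. \<forall>x\<^sub>f<s\<^sub>f.
              \<M> \<rho> a\<^sub>f x\<^sub>f = (\<Sum>\<omega>\<in>\<Omega>. locc_branch r s K P\<^sub>i P\<^sub>o \<omega> \<rho> a\<^sub>f x\<^sub>f)))}"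

end

theory Submission
  imports Defs
begin

text \<open>
  If \<open>\<sigma> a x = (\<Sum>l. P\<^sub>\<Lambda> l * P\<^sub>A a x l * \<xi> l)\<close>, then the output of the map is a mixture over the pairs
  \<open>(\<omega>, l)\<close> of the positive semidefinite operators \<open>P\<^sub>\<Lambda> l * K \<omega> \<xi> (l) (K \<omega>)\<^sup>\<dagger>\<close>, in which Alice
  responds by drawing \<open>x\<close> from \<open>x\<^sub>f\<close> and \<open>\<omega>\<close>, then \<open>a\<close> from \<open>x\<close> and \<open>l\<close>, and then \<open>a\<^sub>f\<close>. The pairs whose
  operator has trace zero contribute nothing, since such an operator vanishes; the traces of the
  others, divided by their total, are the new hidden-variable distribution.
\<close>

subsection \<open>Positive semidefinite matrices\<close>

lemma dagger_add: "dagger (A + B) = dagger A + dagger B"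
  by (simp add: dagger_def vec_eq_iff)

lemma dagger_scaleR: "dagger (c *\<^sub>R A) = c *\<^sub>R dagger A"
  by (simp add: dagger_def vec_eq_iff)

lemma dagger_dagger: "dagger (dagger A) = A"
  by (simp add: dagger_def vec_eq_iff)

lemma dagger_mult: "dagger (A ** B) = dagger B ** dagger A"
  by (simp add: dagger_def vec_eq_iff matrix_matrix_mult_def mult.commute)

text \<open>The adjoint property of \<open>dagger\<close> for the inner product that is antilinear
  in its first argument. It moves \<open>K\<close> off one side of a quadratic form.\<close>

lemma sum_cnj_mult_adjoint:
  fixes K :: "complex ^ 'd::finite ^ 'e::finite"
  shows "(\<Sum>i\<in>UNIV. cnj (v $ i) * (K *v w) $ i) = (\<Sum>j\<in>UNIV. cnj ((dagger K *v v) $ j) * w $ j)"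
proof -
  have "(\<Sum>i\<in>UNIV. cnj (v $ i) * (K *v w) $ i)
      = (\<Sum>i\<in>UNIV. \<Sum>j\<in>UNIV. cnj (v $ i) * (K $ i $ j * w $ j))"
    by (simp add: matrix_vector_mult_def sum_distrib_left)
  also have "\<dots> = (\<Sum>j\<in>UNIV. \<Sum>i\<in>UNIV. cnj (v $ i) * (K $ i $ j * w $ j))"
    by (rule sum.swap)
  also have "\<dots> = (\<Sum>j\<in>UNIV. cnj ((dagger K *v v) $ j) * w $ j)"
    by (simp add: matrix_vector_mult_def dagger_def sum_distrib_left mult_ac)
  finally show ?thesis .
qed

text \<open>Pushes conjugation into the entries of basis vectors, so that sums against them collapse
  to a single term.\<close>

lemma cnj_delta: "cnj (if b then x else 0) = (if b then cnj x else 0)"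
  by simp

lemma psd_zero: "psd 0"
  by (simp add: psd_def dagger_def vec_eq_iff)

lemma psd_add: "psd A \<Longrightarrow> psd B \<Longrightarrow> psd (A + B)"
  by (simp add: psd_def dagger_add matrix_vector_mult_add_rdistrib distrib_left sum.distrib)

lemma psd_scaleR:
  fixes A :: "complex ^ 'd::finite ^ 'd"
  assumes "0 \<le> c" "psd A"
  shows "psd (c *\<^sub>R A)"
proof -
  have "(\<Sum>i\<in>UNIV. cnj (v $ i) * ((c *\<^sub>R A) *v v) $ i)
      = c *\<^sub>R (\<Sum>i\<in>UNIV. cnj (v $ i) * (A *v v) $ i)" for v
    by (simp add: matrix_vector_mult_def scaleR_sum_right sum_distrib_left)
  then show ?thesis
    using assms by (simp add: psd_def dagger_scaleR)
qed

lemma psd_sum: "(\<And>i. i \<in> I \<Longrightarrow> psd (f i)) \<Longrightarrow> psd (\<Sum>i\<in>I. f i)"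
  by (induction I rule: infinite_finite_induct) (auto simp: psd_zero psd_add)

text \<open>The quadratic form at \<open>v\<close> becomes that of \<open>A\<close> at
  \<open>dagger K *v v\<close>, which is nonnegative.\<close>

lemma psd_conjugate:
  fixes K :: "complex ^ 'd::finite ^ 'e::finite"
  assumes "psd A"
  shows "psd (K ** A ** dagger K)"
proof -
  have "(\<Sum>i\<in>UNIV. cnj (v $ i) * ((K ** A ** dagger K) *v v) $ i)
      = (\<Sum>j\<in>UNIV. cnj ((dagger K *v v) $ j) * (A *v (dagger K *v v)) $ j)" for v
    by (simp flip: sum_cnj_mult_adjoint add: matrix_vector_mul_assoc matrix_mul_assoc)
  then show ?thesis
    using assms by (simp add: psd_def dagger_mult dagger_dagger matrix_mul_assoc)
qed

text \<open>Hermiticity makes a diagonal entry real, and the quadratic form at the basis vector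
  \<open>axis i 1\<close> is that entry.\<close>

lemma psd_diagonal:
  assumes "psd A"
  shows "Im (A $ i $ i) = 0" "0 \<le> Re (A $ i $ i)"
proof -
  have "dagger A $ i $ i = A $ i $ i"
    using assms by (simp add: psd_def)
  then show "Im (A $ i $ i) = 0"
    by (simp add: dagger_def complex_eq_iff)
  have "0 \<le> Re (\<Sum>k\<in>UNIV. cnj (axis i 1 $ k) * (A *v axis i 1) $ k)"
    using assms unfolding psd_def by blast
  also have "(\<Sum>k\<in>UNIV. cnj (axis i 1 $ k) * (A *v axis i 1) $ k) = A $ i $ i"
    by (simp add: matrix_vector_mult_def axis_def cnj_delta mult_delta_left
        mult_delta_right)
  finally show "0 \<le> Re (A $ i $ i)" .
qed

lemma psd_trace:
  assumes "psd A"
  shows "trace A = complex_of_real (Re (trace A))" "0 \<le> Re (trace A)"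
  using psd_diagonal[OF assms] by (simp_all add: trace_def complex_eq_iff sum_nonneg)

text \<open>
  Off the diagonal, the quadratic form at \<open>e\<^sub>i + c e\<^sub>j\<close> equals \<open>2 Re (c A\<^sub>i\<^sub>j)\<close>, which is negative for
  \<open>c = - cnj A\<^sub>i\<^sub>j\<close> unless \<open>A\<^sub>i\<^sub>j = 0\<close>.
\<close>

lemma psd_trace_zero:
  fixes A :: "complex ^ 'd::finite ^ 'd"
  assumes A: "psd A" and "Re (trace A) = 0"
  shows "A = 0"
proof -
  have "(\<Sum>i\<in>UNIV. Re (A $ i $ i)) = 0"
    using assms(2) by (simp add: trace_def)
  then have diag: "A $ i $ i = 0" for i
    using psd_diagonal[OF A] by (simp add: sum_nonneg_eq_0_iff complex_eq_iff)
  have "A $ i $ j = 0" for i j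
  proof -
    define c where "c = - cnj (A $ i $ j)"
    \<comment> \<open>Adding the two conditionals, rather than nesting them, keeps the computation
      valid for \<open>i = j\<close> without a case distinction.\<close>
    define v :: "complex ^ 'd" where
      "v = (\<chi> k. (if k = i then 1 else 0) + (if k = j then c else 0))"
    have "(A *v v) $ k = A $ k $ i + A $ k $ j * c" for k
      by (simp add: matrix_vector_mult_def v_def distrib_left sum.distrib
          mult_delta_right)
    then have "(\<Sum>k\<in>UNIV. cnj (v $ k) * (A *v v) $ k)
        = A $ i $ i + A $ i $ j * c + cnj c * (A $ j $ i + A $ j $ j * c)"
      by (simp add: v_def distrib_right sum.distrib cnj_delta
          mult_delta_left)
    also have "A $ j $ i = cnj (A $ i $ j)"
      using A by (simp add: psd_def dagger_def vec_eq_iff)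
    finally have form: "(\<Sum>k\<in>UNIV. cnj (v $ k) * (A *v v) $ k)
        = A $ i $ j * c + cnj (A $ i $ j * c)"
      by (simp add: diag)
    have "0 \<le> Re (\<Sum>k\<in>UNIV. cnj (v $ k) * (A *v v) $ k)"
      using A unfolding psd_def by blast
    then have "0 \<le> Re (A $ i $ j * c + cnj (A $ i $ j * c))"
      unfolding form .
    then have "(Re (A $ i $ j))\<^sup>2 + (Im (A $ i $ j))\<^sup>2 \<le> 0"
      by (simp add: c_def power2_eq_square)
    then show ?thesis
      by (simp add: complex_eq_iff sum_power2_le_zero_iff)
  qed
  then show ?thesis
    by (simp add: vec_eq_iff)
qed

section \<open>Linearity of the trace and of two-sided multiplication\<close>

lemma trace_sum: "trace (\<Sum>i\<in>I. f i) = (\<Sum>i\<in>I. trace (f i))"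
  unfolding trace_def sum_component by (rule sum.swap)

lemma trace_scaleR: "trace (c *\<^sub>R A) = c *\<^sub>R trace A"
  by (simp add: trace_def scaleR_sum_right)

lemma matrix_sandwich_scaleR_sum:
  fixes K :: "complex ^ 'd::finite ^ 'e::finite"
  shows "K ** (\<Sum>l\<in>I. c l *\<^sub>R f l) ** L = (\<Sum>l\<in>I. c l *\<^sub>R (K ** f l ** L))"
proof -
  have "linear (\<lambda>A. K ** A ** L)"
    by (rule linearI) (simp_all add: vec_eq_iff matrix_matrix_mult_def distrib_left distrib_right
        sum.distrib flip: scaleR_sum_right)
  then show ?thesis
    by (simp add: linear_sum[of "\<lambda>A. K ** A ** L"] linear_scale[of "\<lambda>A. K ** A ** L"])
qed

subsection \<open>Mixtures of responses are unsteerable\<close>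

text \<open>The operators \<open>\<eta> i\<close> are unnormalised states: their traces carry the
  weights of the hidden variable. The index type is arbitrary, so that pairs can serve as hidden
  variables.\<close>

lemma mixture_in_LHS:
  fixes \<eta> :: "'i \<Rightarrow> complex ^ 'd::finite ^ 'd" and \<sigma> :: "'d assemblage"
  assumes "finite I" "s \<ge> 1"
    and P: "\<And>x i. x < s \<Longrightarrow> i \<in> I \<Longrightarrow> prob_dist {..<r} (\<lambda>a. P a x i)"
    and \<eta>: "\<And>i. i \<in> I \<Longrightarrow> psd (\<eta> i)"
    and \<sigma>: "\<And>a x. a < r \<Longrightarrow> x < s \<Longrightarrow> \<sigma> a x = (\<Sum>i\<in>I. P a x i *\<^sub>R \<eta> i)"
    and "Tr r \<sigma> \<noteq> 0"
  shows "scale_assemblage (1 / Tr r \<sigma>) \<sigma> \<in> LHS r s"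
proof -
  define T where "T = Tr r \<sigma>"
  define t where "t i = Re (trace (\<eta> i))" for i
  have t_nonneg: "0 \<le> t i" if "i \<in> I" for i
    using psd_trace(2)[OF \<eta>[OF that]] by (simp add: t_def)
  \<comment> \<open>The responses sum to 1 over the outcomes. What remains is independent of the
    input, which yields both no-signaling and the value of \<open>T\<close>.\<close>
  have reduced: "(\<Sum>a<r. \<sigma> a x) = (\<Sum>i\<in>I. \<eta> i)" if "x < s" for x
  proof -
    have "(\<Sum>a<r. \<sigma> a x) = (\<Sum>i\<in>I. \<Sum>a<r. P a x i *\<^sub>R \<eta> i)"
      using that by (simp add: \<sigma>) (rule sum.swap)
    also have "\<dots> = (\<Sum>i\<in>I. \<eta> i)"
      using P[OF that] by (intro sum.cong) (simp_all add: prob_dist_def flip: scaleR_sum_left)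
    finally show ?thesis .
  qed
  have T_sum: "T = (\<Sum>i\<in>I. t i)"
    using reduced[of 0] \<open>s \<ge> 1\<close> by (simp add: T_def Tr_def trace_sum t_def)
  have "T \<ge> 0"
    unfolding T_sum by (rule sum_nonneg) (rule t_nonneg)
  with \<open>Tr r \<sigma> \<noteq> 0\<close> have "T > 0"
    by (simp add: T_def)

  have psd_scaled: "psd ((1 / T) *\<^sub>R \<sigma> a x)" if "a < r" "x < s" for a x
    using that P[OF that(2)] \<open>T > 0\<close>
    by (auto simp: \<sigma> prob_dist_def intro!: psd_scaleR psd_sum \<eta>)
  have assemblage: "assemblage r s (scale_assemblage (1 / T) \<sigma>)"
    using psd_scaled
    by (simp add: assemblage_def scale_assemblage_def reduced flip: scaleR_sum_right)
  have "Tr r (scale_assemblage (1 / T) \<sigma>) = (1 / T) * Tr r \<sigma>"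
    by (simp add: Tr_def scale_assemblage_def trace_scaleR flip: scaleR_sum_right)
  then have normalised: "Tr r (scale_assemblage (1 / T) \<sigma>) = 1"
    using \<open>T > 0\<close> by (simp add: T_def)

  \<comment> \<open>Only indices of nonzero trace can be normalised to density operators.\<close>
  define J where "J = {i \<in> I. t i \<noteq> 0}"
  have "finite J" "J \<subseteq> I"
    using \<open>finite I\<close> by (auto simp: J_def)
  \<comment> \<open>\<open>LHS\<close> takes its hidden variables from the naturals, so
    \<open>J\<close> is enumerated.\<close>
  obtain h where h: "bij_betw h {..<card J} J"
    using ex_bij_betw_nat_finite[OF \<open>finite J\<close>] by (auto simp: atLeast0LessThan)
  have hJ: "h l \<in> I" "t (h l) > 0" if "l < card J" for l
    using bij_betwE[OF h] that t_nonneg by (force simp: J_def less_le)+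
  have "(\<Sum>l<card J. t (h l) / T) = (\<Sum>i\<in>J. t i / T)"
    by (rule sum.reindex_bij_betw[OF h])
  also have "\<dots> = (\<Sum>i\<in>I. t i / T)"
    using \<open>finite I\<close> by (intro sum.mono_neutral_left) (auto simp: J_def)
  also have "\<dots> = 1"
    using \<open>T > 0\<close> by (simp add: T_sum flip: sum_divide_distrib)
  finally have weights: "prob_dist {..<card J} (\<lambda>l. t (h l) / T)"
    using hJ \<open>T > 0\<close> by (simp add: prob_dist_def less_imp_le)
  have states: "density_operator ((1 / t (h l)) *\<^sub>R \<eta> (h l))" if "l < card J" for l
  proof -
    have "trace (\<eta> (h l)) = complex_of_real (t (h l))"
      unfolding t_def by (rule psd_trace(1)[OF \<eta>[OF hJ(1)[OF that]]])
    then show ?thesis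
      using hJ[OF that] by (simp add: density_operator_def trace_scaleR psd_scaleR \<eta>
          scaleR_conv_of_real[where 'a = complex])
  qed
  have decomposition: "(1 / T) *\<^sub>R \<sigma> a x
      = (\<Sum>l<card J. (t (h l) / T * P a x (h l)) *\<^sub>R (1 / t (h l)) *\<^sub>R \<eta> (h l))"
    if "a < r" "x < s" for a x
  proof -
    have "(\<Sum>l<card J. (t (h l) / T * P a x (h l)) *\<^sub>R (1 / t (h l)) *\<^sub>R \<eta> (h l))
        = (\<Sum>i\<in>J. (t i / T * P a x i) *\<^sub>R (1 / t i) *\<^sub>R \<eta> i)"
      by (rule sum.reindex_bij_betw[OF h])
    also have "\<dots> = (\<Sum>i\<in>J. (1 / T) *\<^sub>R P a x i *\<^sub>R \<eta> i)"
      by (intro sum.cong) (auto simp: J_def)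
    \<comment> \<open>The indices outside \<open>J\<close> can be restored: a positive semidefinite
      operator of trace zero is zero.\<close>
    also have "\<dots> = (\<Sum>i\<in>I. (1 / T) *\<^sub>R P a x i *\<^sub>R \<eta> i)"
      using \<open>finite I\<close> by (intro sum.mono_neutral_left) (auto simp: J_def t_def \<eta> psd_trace_zero)
    also have "\<dots> = (1 / T) *\<^sub>R \<sigma> a x"
      using that by (simp add: \<sigma> scaleR_sum_right)
    finally show ?thesis ..
  qed
  show ?thesis
    unfolding LHS_def mem_Collect_eq T_def[symmetric]
  proof (intro conjI exI)
    show "\<forall>x<s. \<forall>l\<in>{..<card J}. prob_dist {..<r} (\<lambda>a. P a x (h l))"
      using P hJ(1) by blast
    show "\<forall>a<r. \<forall>x<s. scale_assemblage (1 / T) \<sigma> a x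
        = (\<Sum>l\<in>{..<card J}. (t (h l) / T * P a x (h l)) *\<^sub>R (1 / t (h l)) *\<^sub>R \<eta> (h l))"
      using decomposition by (simp add: scale_assemblage_def)
  qed (use assemblage normalised weights states in auto)
qed

subsection \<open>Composing the response functions\<close>

text \<open>This is the law of \<open>f\<close> when \<open>x\<close> is drawn from
  \<open>p\<close>, then \<open>a\<close> from \<open>q x\<close>, then \<open>f\<close> from
  \<open>u a x\<close>. The sums are reordered so that the last draw is summed out first, and each
  factor in turn gives 1.\<close>

lemma prob_dist_compose:
  assumes p: "prob_dist S p"
    and q: "\<And>x. x \<in> S \<Longrightarrow> prob_dist R (q x)"
    and u: "\<And>a x. a \<in> R \<Longrightarrow> x \<in> S \<Longrightarrow> prob_dist F (u a x)"
    and "finite F"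
  shows "prob_dist F (\<lambda>f. \<Sum>a\<in>R. \<Sum>x\<in>S. p x * u a x f * q x a)"
proof -
  have "(\<Sum>f\<in>F. \<Sum>a\<in>R. \<Sum>x\<in>S. p x * u a x f * q x a)
      = (\<Sum>a\<in>R. \<Sum>f\<in>F. \<Sum>x\<in>S. p x * u a x f * q x a)"
    by (rule sum.swap)
  also have "\<dots> = (\<Sum>a\<in>R. \<Sum>x\<in>S. \<Sum>f\<in>F. p x * u a x f * q x a)"
    by (intro sum.cong refl sum.swap)
  also have "\<dots> = (\<Sum>a\<in>R. \<Sum>x\<in>S. p x * q x a)"
    using u by (intro sum.cong refl)
      (simp add: prob_dist_def flip: sum_distrib_left sum_distrib_right)
  also have "\<dots> = (\<Sum>x\<in>S. \<Sum>a\<in>R. p x * q x a)"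
    by (rule sum.swap)
  also have "\<dots> = 1"
    using p q by (simp add: prob_dist_def flip: sum_distrib_left)
  finally show ?thesis
    using assms by (auto simp: prob_dist_def intro!: sum_nonneg mult_nonneg_nonneg)
qed

section \<open>Unsteerability of the output assemblage\<close>

theorem theorem1:
  fixes r s r\<^sub>f s\<^sub>f :: nat
    and \<M> :: "'d::finite assemblage \<Rightarrow> 'e::finite assemblage"
    and \<sigma> :: "'d assemblage"
  assumes "r \<ge> 1" "s \<ge> 1" "r\<^sub>f \<ge> 1" "s\<^sub>f \<ge> 1"
    and "\<M> \<in> oneW_LOCC r s r\<^sub>f s\<^sub>f"
    and "\<sigma> \<in> LHS r s"
    and "Tr r\<^sub>f (\<M> \<sigma>) \<noteq> 0"
  shows "scale_assemblage (1 / Tr r\<^sub>f (\<M> \<sigma>)) (\<M> \<sigma>) \<in> LHS r\<^sub>f s\<^sub>f"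
proof -
  obtain \<Omega> :: "nat set" and K P\<^sub>i P\<^sub>o where "finite \<Omega>"
    and P\<^sub>i: "\<forall>\<omega>\<in>\<Omega>. \<forall>x\<^sub>f<s\<^sub>f. prob_dist {..<s} (\<lambda>x. P\<^sub>i x x\<^sub>f \<omega>)"
    and P\<^sub>o: "\<forall>\<omega>\<in>\<Omega>. \<forall>x\<^sub>f<s\<^sub>f. \<forall>a<r. \<forall>x<s. prob_dist {..<r\<^sub>f} (\<lambda>a\<^sub>f. P\<^sub>o a\<^sub>f a x \<omega> x\<^sub>f)"
    and \<M>: "\<forall>\<rho>. assemblage r s \<rho> \<longrightarrow> (\<forall>a\<^sub>f<r\<^sub>f. \<forall>x\<^sub>f<s\<^sub>f.
      \<M> \<rho> a\<^sub>f x\<^sub>f = (\<Sum>\<omega>\<in>\<Omega>. locc_branch r s K P\<^sub>i P\<^sub>o \<omega> \<rho> a\<^sub>f x\<^sub>f))"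
    using assms(5) unfolding oneW_LOCC_def mem_Collect_eq by (elim exE conjE) (rule that)
  obtain \<Lambda> :: "nat set" and P\<^sub>\<Lambda> P\<^sub>A \<xi> where "assemblage r s \<sigma>"
    and P\<^sub>\<Lambda>: "prob_dist \<Lambda> P\<^sub>\<Lambda>"
    and P\<^sub>A: "\<forall>x<s. \<forall>l\<in>\<Lambda>. prob_dist {..<r} (\<lambda>a. P\<^sub>A a x l)"
    and \<xi>: "\<forall>l\<in>\<Lambda>. density_operator (\<xi> l)"
    and \<sigma>: "\<forall>a<r. \<forall>x<s. \<sigma> a x = (\<Sum>l\<in>\<Lambda>. (P\<^sub>\<Lambda> l * P\<^sub>A a x l) *\<^sub>R \<xi> l)"
    using assms(6) unfolding LHS_def mem_Collect_eq by (elim exE conjE) (rule that)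
  define P where
    "P a\<^sub>f x\<^sub>f = (\<lambda>(\<omega>, l). \<Sum>a<r. \<Sum>x<s. P\<^sub>i x x\<^sub>f \<omega> * P\<^sub>o a\<^sub>f a x \<omega> x\<^sub>f * P\<^sub>A a x l)" for a\<^sub>f x\<^sub>f
  \<comment> \<open>With \<open>P\<^sub>\<Lambda> l\<close> absorbed, the trace of
    \<open>\<eta> (\<omega>, l)\<close> is the joint probability of the hidden value
    \<open>l\<close> and Bob's outcome \<omega>.\<close>
  define \<eta> where "\<eta> = (\<lambda>(\<omega>, l). P\<^sub>\<Lambda> l *\<^sub>R (K \<omega> ** \<xi> l ** dagger (K \<omega>)))"
  \<comment> \<open>Conjugation by \<open>K \<omega>\<close> is linear, so it acts on each hidden
    state separately. As \<eta> does not depend on \<open>a\<close> and \<open>x\<close>, the sum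
    over \<open>l\<close> moves outermost and the inner sums form \<open>P\<close>.\<close>
  have branch: "locc_branch r s K P\<^sub>i P\<^sub>o \<omega> \<sigma> a\<^sub>f x\<^sub>f
      = (\<Sum>l\<in>\<Lambda>. P a\<^sub>f x\<^sub>f (\<omega>, l) *\<^sub>R \<eta> (\<omega>, l))" for \<omega> a\<^sub>f x\<^sub>f
  proof -
    have "locc_branch r s K P\<^sub>i P\<^sub>o \<omega> \<sigma> a\<^sub>f x\<^sub>f
        = (\<Sum>a<r. \<Sum>x<s. \<Sum>l\<in>\<Lambda>. (P\<^sub>i x x\<^sub>f \<omega> * P\<^sub>o a\<^sub>f a x \<omega> x\<^sub>f * P\<^sub>A a x l) *\<^sub>R \<eta> (\<omega>, l))"
      by (simp add: locc_branch_def \<sigma> matrix_sandwich_scaleR_sum \<eta>_def scaleR_sum_right mult_ac)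
    also have "\<dots>
        = (\<Sum>a<r. \<Sum>l\<in>\<Lambda>. \<Sum>x<s. (P\<^sub>i x x\<^sub>f \<omega> * P\<^sub>o a\<^sub>f a x \<omega> x\<^sub>f * P\<^sub>A a x l) *\<^sub>R \<eta> (\<omega>, l))"
      by (intro sum.cong refl sum.swap)
    also have "\<dots>
        = (\<Sum>l\<in>\<Lambda>. \<Sum>a<r. \<Sum>x<s. (P\<^sub>i x x\<^sub>f \<omega> * P\<^sub>o a\<^sub>f a x \<omega> x\<^sub>f * P\<^sub>A a x l) *\<^sub>R \<eta> (\<omega>, l))"
      by (rule sum.swap)
    finally show ?thesis
      by (simp add: P_def scaleR_sum_left)
  qed
  show ?thesis
  proof (rule mixture_in_LHS[where I = "\<Omega> \<times> \<Lambda>" and P = P and \<eta> = \<eta>])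
    show "finite (\<Omega> \<times> \<Lambda>)"
      using \<open>finite \<Omega>\<close> P\<^sub>\<Lambda> by (simp add: prob_dist_def)
    show "prob_dist {..<r\<^sub>f} (\<lambda>a\<^sub>f. P a\<^sub>f x\<^sub>f i)" if "x\<^sub>f < s\<^sub>f" "i \<in> \<Omega> \<times> \<Lambda>" for x\<^sub>f i
    proof -
      obtain \<omega> l where i: "i = (\<omega>, l)" "\<omega> \<in> \<Omega>" "l \<in> \<Lambda>"
        using \<open>i \<in> \<Omega> \<times> \<Lambda>\<close> by blast
      show ?thesis
        unfolding i(1) P_def prod.case
        by (rule prob_dist_compose[where p = "\<lambda>x. P\<^sub>i x x\<^sub>f \<omega>" and q = "\<lambda>x a. P\<^sub>A a x l"
              and u = "\<lambda>a x a\<^sub>f. P\<^sub>o a\<^sub>f a x \<omega> x\<^sub>f"])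
          (use P\<^sub>i P\<^sub>o P\<^sub>A i \<open>x\<^sub>f < s\<^sub>f\<close> in auto)
    qed
    show "psd (\<eta> i)" if "i \<in> \<Omega> \<times> \<Lambda>" for i
      using that P\<^sub>\<Lambda> \<xi>
      by (auto simp: \<eta>_def prob_dist_def density_operator_def intro!: psd_scaleR psd_conjugate)
    show "\<M> \<sigma> a\<^sub>f x\<^sub>f = (\<Sum>i\<in>\<Omega> \<times> \<Lambda>. P a\<^sub>f x\<^sub>f i *\<^sub>R \<eta> i)" if "a\<^sub>f < r\<^sub>f" "x\<^sub>f < s\<^sub>f" for a\<^sub>f x\<^sub>f
      using \<M> \<open>assemblage r s \<sigma>\<close> that by (simp add: branch sum.cartesian_product)
  qed (use assms in auto)
qed

end
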